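(* Let $\mathscr{A}$ be a $C^*$-algebra, $\mathscr{X}$ a Hilbert $\mathscr{A}$-module, $\mathscr{Y}$ a closed submodule of $\mathscr{X}$, and $B:\mathscr{X}\times\mathscr{X}\to\mathscr{A}$ a bounded $\mathscr{A}$-sesquilinear form. Suppose that the $B$-spline interpolation problem for $\mathscr{Y}$ has a solution for an element $x\in\mathscr{X}$. Then the following two conditions are equivalent: (1) The solution of the $B$-spline problem for $x$ is unique. (2) $\{z\in\mathscr{Y}:B(z,y)=0\text{ for all }y\in\mathscr{Y}\}=\{0\}$. Moreover, if condition (2) holds, then for any other element of $\mathscr{X}$ for which the $B$-spline problem with respect to $\mathscr{Y}$ has a solution, that solution is unique.
   Context: A bounded $\mathscr{A}$-sesquilinear form is a bounded map $B$ that is anti-$\mathscr{A}$-linear in the first and $\mathscr{A}$-linear in the second variable ($B(xa,yb)=a^*B(x,y)b$; Hilbert modules are right modules). A solution of the $B$-spline (interpolation) problem for $x\in\mathscr{X}$ with respect to $\mathscr{Y}$ is an element $s\in x+\mathscr{Y}$ such that $B(s,y)=0$ for all $y\in\mathscr{Y}$. *)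

theory Defs
  imports "HOL-Analysis.Analysis"
begin

text \<open>The unit law of the complex scaling follows from \<open>scaleR_scaleC\<close>.\<close>

class complex_normed_vector = real_normed_vector +
  fixes scaleC :: "complex \<Rightarrow> 'a \<Rightarrow> 'a" (infixr "*\<^sub>C" 75)
  assumes scaleR_scaleC: "r *\<^sub>R x = complex_of_real r *\<^sub>C x"
    and scaleC_add_right: "c *\<^sub>C (x + y) = c *\<^sub>C x + c *\<^sub>C y"
    and scaleC_add_left: "(c + d) *\<^sub>C x = c *\<^sub>C x + d *\<^sub>C x"
    and scaleC_scaleC: "c *\<^sub>C d *\<^sub>C x = (c * d) *\<^sub>C x"
    and norm_scaleC: "norm (c *\<^sub>C x) = cmod c * norm x"

class cbanach = complex_normed_vector + banach

text \<open>C*-algebras, not assumed to be unital or commutative.\<close>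

class cstar_algebra = cbanach + real_normed_algebra +
  fixes star :: "'a \<Rightarrow> 'a"
  assumes mult_scaleC_left: "(c *\<^sub>C a) * b = c *\<^sub>C (a * b)"
    and mult_scaleC_right: "a * (c *\<^sub>C b) = c *\<^sub>C (a * b)"
    and star_add: "star (a + b) = star a + star b"
    and star_scaleC: "star (c *\<^sub>C a) = cnj c *\<^sub>C star a"
    and star_mult: "star (a * b) = star b * star a"
    and star_star: "star (star a) = a"
    and cstar_identity: "norm (star a * a) = (norm a)\<^sup>2"

definition cstar_positive :: "'a::cstar_algebra \<Rightarrow> bool" where
  "cstar_positive a \<longleftrightarrow> (\<exists>b. a = star b * b)"

text \<open>
  Right Hilbert modules over a C*-algebra; the inner product is linear in the second variable.
  As in the library class \<open>real_inner\<close>, the norm of the type is required to be the one induced by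
  the inner product, so \<open>cbanach\<close> expresses completeness of the module in that norm.
\<close>

locale hilbert_module =
  fixes act :: "'x::cbanach \<Rightarrow> 'a::cstar_algebra \<Rightarrow> 'x"
    and ip :: "'x \<Rightarrow> 'x \<Rightarrow> 'a"
  assumes act_add_left: "act (x + y) a = act x a + act y a"
    and act_add_right: "act x (a + b) = act x a + act x b"
    and act_mult: "act x (a * b) = act (act x a) b"
    and act_scaleC_left: "act (c *\<^sub>C x) a = c *\<^sub>C act x a"
    and act_scaleC_right: "act x (c *\<^sub>C a) = c *\<^sub>C act x a"
    and ip_add_right: "ip x (y + z) = ip x y + ip x z"
    and ip_scaleC_right: "ip x (c *\<^sub>C y) = c *\<^sub>C ip x y"
    and ip_act_right: "ip x (act y a) = ip x y * a"
    and star_ip: "star (ip x y) = ip y x"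
    and ip_positive: "cstar_positive (ip x x)"
    and ip_eq_zero_iff: "ip x x = 0 \<longleftrightarrow> x = 0"
    and norm_eq_sqrt_ip: "norm x = sqrt (norm (ip x x))"

definition closed_submodule ::
    "('x::cbanach \<Rightarrow> 'a::cstar_algebra \<Rightarrow> 'x) \<Rightarrow> 'x set \<Rightarrow> bool" where
  "closed_submodule act Y \<longleftrightarrow>
     closed Y \<and> 0 \<in> Y \<and> (\<forall>y\<in>Y. \<forall>z\<in>Y. y + z \<in> Y) \<and>
     (\<forall>c. \<forall>y\<in>Y. c *\<^sub>C y \<in> Y) \<and> (\<forall>a. \<forall>y\<in>Y. act y a \<in> Y)"

text \<open>
  \<open>bounded_bilinear\<close> is bilinearity over the reals together with a bound
  \<open>norm (B x y) \<le> norm x * norm y * K\<close>.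
\<close>

definition bounded_sesquilinear_form ::
    "('x::cbanach \<Rightarrow> 'a::cstar_algebra \<Rightarrow> 'x) \<Rightarrow> ('x \<Rightarrow> 'x \<Rightarrow> 'a) \<Rightarrow> bool" where
  "bounded_sesquilinear_form act B \<longleftrightarrow>
     bounded_bilinear B \<and>
     (\<forall>c d x y. B (c *\<^sub>C x) (d *\<^sub>C y) = (cnj c * d) *\<^sub>C B x y) \<and>
     (\<forall>x y a b. B (act x a) (act y b) = star a * B x y * b)"

definition spline_solution ::
    "('x::cbanach \<Rightarrow> 'x \<Rightarrow> 'a::cstar_algebra) \<Rightarrow> 'x set \<Rightarrow> 'x \<Rightarrow> 'x \<Rightarrow> bool" where
  "spline_solution B Y x s \<longleftrightarrow> s \<in> (+) x ` Y \<and> (\<forall>y\<in>Y. B s y = 0)"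

end

theory Submission
  imports Defs
begin

text \<open>Let K be the set of all z in \<open>Y\<close> with \<open>B z y = 0\<close> for every y
  in \<open>Y\<close>. Two solutions for the same point differ by an element of \<open>Y\<close>,
  and additivity of \<open>B\<close> in the first variable puts this difference in K; conversely,
  adding an element of K to a solution gives a solution. So the solutions, if any, form a coset s +
  K (\<open>spline_solutions_eq_translate\<close>), which is a single point exactly when K = {0}
  (\<open>spline_solution_unique_iff\<close>). As K does not depend on the point, the criterion
  passes to every other solvable point.\<close>

lemma closed_submodule_diff:
  assumes "closed_submodule act Y" "y \<in> Y" "z \<in> Y"
  shows "y - z \<in> Y"
proof -
  \<comment> \<open>Closure under negation comes from closure under complex scalars, with -1 reached
    through the real scaling.\<close>
  have "(- 1) *\<^sub>C z = - z"
    using scaleR_scaleC[of "- 1" z] by simp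
  then have "- z \<in> Y"
    using assms(1,3) by (auto simp: closed_submodule_def simp flip: \<open>(- 1) *\<^sub>C z = - z\<close>)
  then have "y + (- z) \<in> Y"
    using assms(1,2) by (simp only: closed_submodule_def)
  then show ?thesis by simp
qed

text \<open>As for an inhomogeneous linear system: a particular solution plus the solutions of the
  homogeneous problem, which is the case \<open>x = 0\<close>.\<close>

lemma spline_solutions_eq_translate:
  assumes Y: "closed_submodule act Y"
    and B: "bounded_sesquilinear_form act B"
    and s: "spline_solution B Y x s"
  shows "{t. spline_solution B Y x t} = (+) s ` {z \<in> Y. \<forall>y\<in>Y. B z y = 0}"
proof -
  interpret bounded_bilinear B
    using B by (simp add: bounded_sesquilinear_form_def)
  obtain u where u: "s = x + u" "u \<in> Y" and s0: "\<forall>y\<in>Y. B s y = 0"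
    using s by (auto simp: spline_solution_def)
  show ?thesis
  proof (intro equalityI subsetI)
    fix t assume "t \<in> {t. spline_solution B Y x t}"
    then obtain v where v: "t = x + v" "v \<in> Y" and t0: "\<forall>y\<in>Y. B t y = 0"
      by (auto simp: spline_solution_def)
    \<comment> \<open>The base point cancels: \<open>t - s = v - u\<close>.\<close>
    have "t - s \<in> Y"
      using closed_submodule_diff[OF Y v(2) u(2)] u v by simp
    moreover have "\<forall>y\<in>Y. B (t - s) y = 0"
      using s0 t0 by (simp add: diff_left)
    ultimately show "t \<in> (+) s ` {z \<in> Y. \<forall>y\<in>Y. B z y = 0}"
      by (intro image_eqI[of _ _ "t - s"]) auto
  next
    fix t assume "t \<in> (+) s ` {z \<in> Y. \<forall>y\<in>Y. B z y = 0}"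
    then obtain z where z: "t = s + z" "z \<in> Y" "\<forall>y\<in>Y. B z y = 0"
      by blast
    have "t = x + (u + z)" "u + z \<in> Y"
      using u z Y by (auto simp: closed_submodule_def add.assoc)
    then show "t \<in> {t. spline_solution B Y x t}"
      using s0 z by (auto simp: spline_solution_def add_left)
  qed
qed

lemma spline_solution_unique_iff:
  assumes Y: "closed_submodule act Y"
    and B: "bounded_sesquilinear_form act B"
    and ex: "\<exists>s. spline_solution B Y x s"
  shows "(\<exists>!s. spline_solution B Y x s) \<longleftrightarrow> {z \<in> Y. \<forall>y\<in>Y. B z y = 0} = {0}"
proof -
  let ?K = "{z \<in> Y. \<forall>y\<in>Y. B z y = 0}"
  obtain s where s: "spline_solution B Y x s"
    using ex by blast
  have "(\<exists>!t. spline_solution B Y x t) \<longleftrightarrow> {t. spline_solution B Y x t} = {s}"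
    using s unfolding set_eq_iff mem_Collect_eq singleton_iff by metis
  \<comment> \<open>Writing \<open>{s}\<close> as the translate of \<open>{0}\<close> lets
    injectivity of translation by \<open>s\<close> cancel \<open>s\<close> on both sides.\<close>
  also have "\<dots> \<longleftrightarrow> (+) s ` ?K = (+) s ` {0}"
    using spline_solutions_eq_translate[OF Y B s] by simp
  also have "\<dots> \<longleftrightarrow> ?K = {0}"
    by (rule inj_image_eq_iff) simp
  finally show ?thesis .
qed

theorem proposition3p4:
  fixes act :: "'x::cbanach \<Rightarrow> 'a::cstar_algebra \<Rightarrow> 'x"
    and ip B :: "'x \<Rightarrow> 'x \<Rightarrow> 'a"
    and Y :: "'x set"
    and x :: 'x
  assumes "hilbert_module act ip"
    and "closed_submodule act Y"
    and "bounded_sesquilinear_form act B"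
    and "\<exists>s. spline_solution B Y x s"
  shows "((\<exists>!s. spline_solution B Y x s) \<longleftrightarrow> {z \<in> Y. \<forall>y\<in>Y. B z y = 0} = {0}) \<and>
         ({z \<in> Y. \<forall>y\<in>Y. B z y = 0} = {0} \<longrightarrow>
           (\<forall>x'. (\<exists>s. spline_solution B Y x' s) \<longrightarrow> (\<exists>!s. spline_solution B Y x' s)))"
proof (intro conjI impI allI)
  show "(\<exists>!s. spline_solution B Y x s) \<longleftrightarrow> {z \<in> Y. \<forall>y\<in>Y. B z y = 0} = {0}"
    by (rule spline_solution_unique_iff[OF assms(2-4)])
next
  fix x'
  assume "{z \<in> Y. \<forall>y\<in>Y. B z y = 0} = {0}" and "\<exists>s. spline_solution B Y x' s"
  then show "\<exists>!s. spline_solution B Y x' s"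
    \<comment> \<open>Solvability at \<open>x'\<close> discharges the premise of the criterion,
      whose right-hand side is the same for \<open>x'\<close> as for \<open>x\<close>.\<close>
    by (simp only: spline_solution_unique_iff[OF assms(2,3)])
qed

end
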